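(* Let $\alpha,\beta>0$, let $\mathcal{A}:\mathbb{R}^{n_1\times n_2}\to\mathbb{R}^{n_3}$ be linear, let $m=\min\{n_1,n_2\}$ and let $1\le r\le m$. Suppose that $$(1+\beta\alpha)\sum_{i=1}^r\sigma_i(H)\le\sum_{i=r+1}^m\sigma_i(H)$$ holds for all matrices $H\in\mathbb{R}^{n_1\times n_2}$ with $\mathcal{A}H=0$. Then for every matrix $X_0\in\mathbb{R}^{n_1\times n_2}$ of rank $r$ or less, with $b=\mathcal{A}X_0$, the matrix $X_0$ is the unique solution of $$\min_{X\in\mathbb{R}^{n_1\times n_2}}\{\|X\|_*+\beta\hat\Phi(X):\mathcal{A}X=b\}.$$
   Context: $\sigma_1(X)\ge\dots\ge\sigma_m(X)\ge0$ are the singular values of $X\in\mathbb{R}^{n_1\times n_2}$, $\|X\|_*=\sum_{i=1}^m\sigma_i(X)$ is the nuclear norm, and $\hat\Phi(X)=\sum_{i=1}^m\varphi(\sigma_i(X))$ with $\varphi(t)=\frac{\alpha|t|}{1+\alpha|t|}$. *)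

theory Defs
  imports "HOL-Analysis.Analysis" "HOL-Computational_Algebra.Polynomial"
begin

text \<open>An \<open>n\<^sub>1 \<times> n\<^sub>2\<close> real matrix is an element of \<open>real ^ 'n2 ^ 'n1\<close> (rows indexed by \<open>'n1\<close>).\<close>

definition char_polynomial :: "'a::comm_ring_1 ^ 'n ^ 'n \<Rightarrow> 'a poly"
  where "char_polynomial M = det (mat [:0, 1:] - (\<chi> i j. [: M $ i $ j :]))"

text \<open>The singular values are the square roots of the eigenvalues of \<open>X\<^sup>T X\<close>, counted with
  multiplicity (as roots of the characteristic polynomial) and listed in decreasing order.
  Since \<open>X\<^sup>T X\<close> is symmetric positive semidefinite of size \<open>n\<^sub>2\<close>, all its eigenvalues are real and
  nonnegative and the list has length \<open>n\<^sub>2\<close>.\<close>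

definition singular_values :: "real ^ 'n2 ^ 'n1 \<Rightarrow> real list"
  where "singular_values X =
    rev (sorted_list_of_multiset
      (image_mset sqrt (proots (char_polynomial (transpose X ** X)))))"

text \<open>Indexing starts at 1; only the indices \<open>1 \<le> i \<le> min n\<^sub>1 n\<^sub>2\<close> are used below.\<close>

definition singular_value :: "nat \<Rightarrow> real ^ 'n2 ^ 'n1 \<Rightarrow> real"
  where "singular_value i X = singular_values X ! (i - 1)"

definition nuclear_norm :: "real ^ 'n2 ^ 'n1 \<Rightarrow> real"
  where "nuclear_norm X = (\<Sum>i = 1..min CARD('n1) CARD('n2). singular_value i X)"

definition frac_penalty :: "real \<Rightarrow> real \<Rightarrow> real"
  where "frac_penalty \<alpha> t = \<alpha> * \<bar>t\<bar> / (1 + \<alpha> * \<bar>t\<bar>)"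

definition spectral_penalty :: "real \<Rightarrow> real ^ 'n2 ^ 'n1 \<Rightarrow> real"
  where "spectral_penalty \<alpha> X =
    (\<Sum>i = 1..min CARD('n1) CARD('n2). frac_penalty \<alpha> (singular_value i X))"

end

theory Submission
  imports Defs
begin

text \<open>Put \<open>H = X - X\<^sub>0\<close> and let \<open>h\<close> be the sum of the \<open>r\<close> largest singular values of \<open>H\<close>. Two
  perturbation inequalities hold because \<open>X\<^sub>0\<close> has rank at most \<open>r\<close>: first
  \<open>\<parallel>X\<parallel>\<^sub>* \<ge> \<parallel>X\<^sub>0\<parallel>\<^sub>* + \<parallel>H\<parallel>\<^sub>* - 2h\<close>, which the null space condition turns into
  \<open>\<parallel>X\<parallel>\<^sub>* \<ge> \<parallel>X\<^sub>0\<parallel>\<^sub>* + \<beta>\<alpha>h\<close>; second, since \<open>\<phi>\<close> is concave with slope at most \<open>\<alpha>\<close>, the penalty of \<open>X\<^sub>0\<close>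
  exceeds that of \<open>X\<close> by less than \<open>\<alpha>h\<close> unless \<open>H = 0\<close>. Both rest on Ky Fan's bound for the Frobenius
  inner product of \<open>H\<close> with an operator of rank at most \<open>r\<close>.\<close>

section \<open>Orthonormal families in Euclidean spaces\<close>

text \<open>Natural indices let a family share its indices with the ordered singular values. Values
  from \<open>n\<close> on are free, so a family can be truncated or extended by function
  update.\<close>

definition orthonormal :: "(nat \<Rightarrow> 'a::real_inner) \<Rightarrow> nat \<Rightarrow> bool"
  where "orthonormal v n \<longleftrightarrow> (\<forall>i<n. \<forall>j<n. v i \<bullet> v j = (if i = j then 1 else 0))"

lemma orthonormal_inner:
  "orthonormal v n \<Longrightarrow> i < n \<Longrightarrow> j < n \<Longrightarrow> v i \<bullet> v j = (if i = j then 1 else 0)"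
  by (auto simp: orthonormal_def)

lemma orthonormal_norm: "orthonormal v n \<Longrightarrow> i < n \<Longrightarrow> norm (v i) = 1"
  by (simp add: norm_eq_sqrt_inner orthonormal_inner)

lemma orthonormal_mono: "orthonormal v n \<Longrightarrow> k \<le> n \<Longrightarrow> orthonormal v k"
  by (auto simp: orthonormal_def)

lemma orthonormal_inj: "orthonormal v n \<Longrightarrow> inj_on v {..<n}"
  by (rule inj_onI) (metis lessThan_iff orthonormal_inner zero_neq_one)

lemma orthonormal_upd:
  assumes "orthonormal v n" and "norm y = 1" and "\<And>j. j < n \<Longrightarrow> v j \<bullet> y = 0"
  shows "orthonormal (v(n := y)) (Suc n)"
  using assms by (auto simp: orthonormal_def less_Suc_eq inner_commute norm_eq_1)

lemma orthonormal_independent: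
  fixes v :: "nat \<Rightarrow> 'a::euclidean_space"
  assumes "orthonormal v n"
  shows "independent (v ` {..<n})"
proof (rule pairwise_orthogonal_independent)
  show "pairwise orthogonal (v ` {..<n})"
    using assms by (auto simp: pairwise_def orthogonal_def orthonormal_inner)
  show "0 \<notin> v ` {..<n}"
    using orthonormal_norm[OF assms] by fastforce
qed

lemma orthonormal_le_dim:
  fixes v :: "nat \<Rightarrow> 'a::euclidean_space"
  assumes "orthonormal v n" and "v ` {..<n} \<subseteq> S"
  shows "n \<le> dim S"
proof -
  have "card (v ` {..<n}) \<le> dim S"
    using assms(2) orthonormal_independent[OF assms(1)] by (intro independent_card_le_dim)
  then show ?thesis
    by (simp add: card_image orthonormal_inj[OF assms(1)])
qed

lemma orthonormal_le_DIM:
  fixes v :: "nat \<Rightarrow> 'a::euclidean_space"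
  shows "orthonormal v n \<Longrightarrow> n \<le> DIM('a)"
  using orthonormal_le_dim[of v n UNIV] by simp

lemma orthonormal_vector_exists:
  fixes v :: "nat \<Rightarrow> 'a::euclidean_space"
  assumes "n < DIM('a)"
  obtains y where "norm y = 1" and "\<And>j. j < n \<Longrightarrow> v j \<bullet> y = 0"
proof -
  have "dim (v ` {..<n}) \<le> card (v ` {..<n})"
    by (intro dim_le_card') simp
  also have "\<dots> \<le> n"
    using card_image_le[of "{..<n}" v] by simp
  finally obtain x where "x \<noteq> 0" and x: "\<And>y. y \<in> span (v ` {..<n}) \<Longrightarrow> orthogonal x y"
    using orthogonal_to_subspace_exists[of "v ` {..<n}"] assms by auto
  show ?thesis
  proof (rule that[of "x /\<^sub>R norm x"])
    show "norm (x /\<^sub>R norm x) = 1"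
      using \<open>x \<noteq> 0\<close> by simp
    show "v j \<bullet> (x /\<^sub>R norm x) = 0" if "j < n" for j
      using x[OF span_base[of "v j"]] that by (auto simp: orthogonal_def inner_commute)
  qed
qed

lemma orthonormal_extend:
  fixes v :: "nat \<Rightarrow> 'a::euclidean_space"
  assumes "orthonormal v k" and "k \<le> n" and "n \<le> DIM('a)"
  obtains w where "orthonormal w n" and "\<And>i. i < k \<Longrightarrow> w i = v i"
proof -
  have "\<exists>w. orthonormal w n \<and> (\<forall>i<k. w i = v i)"
    using assms(2,3)
  proof (induction n rule: dec_induct)
    case base
    show ?case using assms(1) by blast
  next
    case (step n)
    then obtain w where w: "orthonormal w n" "\<forall>i<k. w i = v i" by auto
    obtain y where "norm y = 1" "\<And>j. j < n \<Longrightarrow> w j \<bullet> y = 0"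
      using orthonormal_vector_exists[of n w] step.prems by auto
    then have "orthonormal (w(n := y)) (Suc n)"
      by (intro orthonormal_upd w)
    moreover have "\<forall>i<k. (w(n := y)) i = v i"
      using w(2) step.hyps by simp
    ultimately show ?case
      by blast
  qed
  then show ?thesis using that by blast
qed

text \<open>A nonzero residual \<open>y\<close> would be orthogonal to every \<open>v i\<close>, and
  its normalization would give one orthonormal vector more than the dimension allows.\<close>

lemma orthonormal_expand:
  fixes v :: "nat \<Rightarrow> 'a::euclidean_space"
  assumes "orthonormal v DIM('a)"
  shows "(\<Sum>j<DIM('a). (v j \<bullet> x) *\<^sub>R v j) = x"
proof (rule ccontr)
  define y where "y = x - (\<Sum>j<DIM('a). (v j \<bullet> x) *\<^sub>R v j)"
  assume "\<not> ?thesis"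
  then have "y \<noteq> 0" by (auto simp: y_def)
  have "v i \<bullet> y = 0" if "i < DIM('a)" for i
  proof -
    have "(\<Sum>j<DIM('a). (v j \<bullet> x) * (v i \<bullet> v j)) = (\<Sum>j<DIM('a). if j = i then v j \<bullet> x else 0)"
      using that by (intro sum.cong) (auto simp: orthonormal_inner[OF assms])
    then show ?thesis
      using that by (simp add: y_def inner_diff_right inner_sum_right)
  qed
  then have "orthonormal (v(DIM('a) := y /\<^sub>R norm y)) (Suc DIM('a))"
    using \<open>y \<noteq> 0\<close> by (intro orthonormal_upd assms) auto
  then show False
    using orthonormal_le_DIM by fastforce
qed

lemma orthonormal_parseval:
  fixes v :: "nat \<Rightarrow> 'a::euclidean_space"
  assumes "orthonormal v DIM('a)"
  shows "(\<Sum>j<DIM('a). (v j \<bullet> x) * (v j \<bullet> y)) = x \<bullet> y"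
proof -
  have "x \<bullet> y = (\<Sum>j<DIM('a). (v j \<bullet> x) *\<^sub>R v j) \<bullet> y"
    by (simp add: orthonormal_expand[OF assms])
  then show ?thesis
    by (simp add: inner_sum_left)
qed

lemma orthonormal_bessel:
  fixes v :: "nat \<Rightarrow> 'a::euclidean_space"
  assumes "orthonormal v n"
  shows "(\<Sum>j<n. (v j \<bullet> x)\<^sup>2) \<le> (norm x)\<^sup>2"
proof -
  obtain w where w: "orthonormal w DIM('a)" "\<And>i. i < n \<Longrightarrow> w i = v i"
    using orthonormal_extend[OF assms orthonormal_le_DIM[OF assms]] by blast
  have "(\<Sum>j<n. (v j \<bullet> x)\<^sup>2) = (\<Sum>j<n. (w j \<bullet> x)\<^sup>2)"
    using w by simp
  also have "\<dots> \<le> (\<Sum>j<DIM('a). (w j \<bullet> x)\<^sup>2)"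
    using orthonormal_le_DIM[OF assms] by (intro sum_mono2) auto
  also have "\<dots> = (norm x)\<^sup>2"
    using orthonormal_parseval[OF w(1), of x x] by (simp add: power2_norm_eq_inner) (simp add: power2_eq_square)
  finally show ?thesis .
qed

lemma inner_orthonormal_sum:
  assumes "orthonormal u n"
  shows "(\<Sum>j<n. c j *\<^sub>R u j) \<bullet> (\<Sum>j<n. d j *\<^sub>R u j) = (\<Sum>j<n. c j * d j)"
proof -
  have "(\<Sum>j<n. c j *\<^sub>R u j) \<bullet> (\<Sum>j<n. d j *\<^sub>R u j) = (\<Sum>j<n. \<Sum>i<n. d j * (c i * (u i \<bullet> u j)))"
    unfolding inner_sum_left inner_sum_right by simp
  also have "\<dots> = (\<Sum>j<n. \<Sum>i<n. if i = j then c j * d j else 0)"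
    by (intro sum.cong) (auto simp: orthonormal_inner[OF assms])
  finally show ?thesis
    by simp
qed

lemma norm_orthonormal_sum:
  assumes "orthonormal u n"
  shows "(norm (\<Sum>j<n. c j *\<^sub>R u j))\<^sup>2 = (\<Sum>j<n. (c j)\<^sup>2)"
  unfolding power2_norm_eq_inner inner_orthonormal_sum[OF assms] by (simp add: power2_eq_square)

text \<open>\<open>F\<close> is the partial isometry that carries the frame \<open>v\<close> to
  \<open>u\<close> and kills the orthogonal complement of \<open>v\<close>. The polar factors in the
  perturbation inequalities have this form.\<close>

lemma orthonormal_map:
  fixes v :: "nat \<Rightarrow> 'a::euclidean_space" and u :: "nat \<Rightarrow> 'b::euclidean_space"
  assumes "orthonormal v k" and "orthonormal u k"
  defines "F \<equiv> \<lambda>x. \<Sum>j<k. (v j \<bullet> x) *\<^sub>R u j"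
  shows "linear F" and "norm (F x) \<le> norm x" and "\<And>j. j < k \<Longrightarrow> F (v j) = u j"
    and "dim (range F) \<le> k"
proof -
  show "linear F"
    by (rule linearI) (simp_all add: F_def inner_add_right scaleR_add_left sum.distrib scaleR_sum_right)
  have "(norm (F x))\<^sup>2 \<le> (norm x)\<^sup>2"
    unfolding F_def norm_orthonormal_sum[OF assms(2)] by (rule orthonormal_bessel[OF assms(1)])
  then show "norm (F x) \<le> norm x"
    by (rule power2_le_imp_le) simp
  show "F (v j) = u j" if "j < k" for j
  proof -
    have "F (v j) = (\<Sum>i<k. if i = j then u i else 0)"
      unfolding F_def using that by (intro sum.cong) (auto simp: orthonormal_inner[OF assms(1)])
    then show ?thesis using that by simp
  qed
  have "range F \<subseteq> span (u ` {..<k})"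
    unfolding F_def by (intro image_subsetI span_sum span_scale) (auto intro: span_base)
  then have "dim (range F) \<le> card (u ` {..<k})"
    by (rule dim_le_card) simp
  also have "\<dots> \<le> k"
    using card_image_le[of "{..<k}" u] by simp
  finally show "dim (range F) \<le> k" .
qed

lemma orthonormal_basis_nat:
  fixes S :: "'a::euclidean_space set"
  assumes "subspace S"
  obtains e where "orthonormal e (dim S)"
    and "\<And>x. x \<in> S \<Longrightarrow> (\<Sum>i<dim S. (e i \<bullet> x) *\<^sub>R e i) = x"
proof -
  obtain B where B: "B \<subseteq> S" "pairwise orthogonal B" "\<And>x. x \<in> B \<Longrightarrow> norm x = 1"
    "independent B" "card B = dim S" "span B = S"
    using orthonormal_basis_subspace[OF assms] by blast
  have "finite B"
    using B(4) by (rule independent_imp_finite)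
  then obtain e where e: "bij_betw e {0..<card B} B"
    using ex_bij_betw_nat_finite by blast
  have on: "orthonormal e (dim S)"
    unfolding orthonormal_def
  proof (intro allI impI)
    fix i j assume ij: "i < dim S" "j < dim S"
    then have eB: "e i \<in> B" "e j \<in> B"
      using bij_betwE[OF e] B(5) by auto
    show "e i \<bullet> e j = (if i = j then 1 else 0)"
    proof (cases "i = j")
      case True
      then show ?thesis using B(3)[OF eB(1)] by (simp add: norm_eq_1)
    next
      case False
      then have "e i \<noteq> e j"
        using e ij B(5) by (auto simp: bij_betw_def inj_on_def)
      then show ?thesis
        using B(2) eB False by (auto simp: pairwise_def orthogonal_def)
    qed
  qed
  have img: "e ` {..<dim S} = B"
    using e B(5) by (simp add: bij_betw_def lessThan_atLeast0)
  have "(\<Sum>i<dim S. (e i \<bullet> x) *\<^sub>R e i) = x" if "x \<in> S" for x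
  proof -
    define y where "y = x - (\<Sum>i<dim S. (e i \<bullet> x) *\<^sub>R e i)"
    have "e i \<in> S" if "i < dim S" for i
      using img B(1) that by blast
    then have "y \<in> S"
      unfolding y_def using assms that by (intro subspace_diff subspace_sum subspace_scale) auto
    have "y \<bullet> b = 0" if "b \<in> B" for b
    proof -
      obtain k where k: "k < dim S" "b = e k"
        using img \<open>b \<in> B\<close> by auto
      have "(\<Sum>i<dim S. (e i \<bullet> x) * (e i \<bullet> e k)) = (\<Sum>i<dim S. if i = k then e i \<bullet> x else 0)"
        using k by (intro sum.cong) (auto simp: orthonormal_inner[OF on])
      then show ?thesis
        using k by (simp add: y_def inner_diff_left inner_sum_left inner_commute[of x])
    qed
    then have "orthogonal y y"
      using \<open>y \<in> S\<close> B(6) by (intro orthogonal_to_span[of y B]) (auto simp: orthogonal_def)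
    then have "y = 0"
      by (simp add: orthogonal_self)
    then show ?thesis
      unfolding y_def by (rule right_minus_eq[THEN iffD1, symmetric])
  qed
  then show ?thesis
    using on that by blast
qed

section \<open>Ky Fan's bound for the Frobenius inner product\<close>

lemma norm_adjoint_le:
  fixes D :: "'a::euclidean_space \<Rightarrow> 'b::euclidean_space"
  assumes "linear D" and "\<And>x. norm (D x) \<le> c * norm x" and "0 \<le> c"
  shows "norm (adjoint D y) \<le> c * norm y"
proof -
  let ?a = "adjoint D y"
  have "(norm ?a)\<^sup>2 = D ?a \<bullet> y"
    by (simp add: power2_norm_eq_inner adjoint_works[OF assms(1)])
  also have "\<dots> \<le> norm (D ?a) * norm y"
    by (rule norm_cauchy_schwarz)
  also have "\<dots> \<le> (c * norm ?a) * norm y"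
    by (intro mult_right_mono assms) simp
  finally have *: "norm ?a * norm ?a \<le> (c * norm y) * norm ?a"
    by (simp add: power2_eq_square algebra_simps)
  then show ?thesis
    using assms(3) by (cases "?a = 0") auto
qed

text \<open>Each weight \<open>q j\<close> is capped by \<open>c\<close> and the total budget is
  \<open>c * r\<close>, so the best choice spends the whole budget on the \<open>r\<close> largest
  values of \<open>h\<close>.\<close>

lemma weighted_sum_le_top:
  fixes h q :: "nat \<Rightarrow> real"
  assumes anti: "\<And>i j. i \<le> j \<Longrightarrow> j < m \<Longrightarrow> h j \<le> h i" and nonneg: "\<And>j. j < m \<Longrightarrow> 0 \<le> h j"
    and q: "\<And>j. j < m \<Longrightarrow> q j \<le> c" "\<And>j. j < m \<Longrightarrow> 0 \<le> q j"
    and sum_q: "(\<Sum>j<m. q j) \<le> c * real r" and "r \<le> m"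
  shows "(\<Sum>j<m. h j * q j) \<le> c * (\<Sum>j<r. h j)"
proof -
  \<comment> \<open>The threshold separates the top \<open>r\<close> values from the rest; for
    \<open>r = m\<close> there is no next value, and 0 bounds all of them from below.\<close>
  define t where "t = (if r < m then h r else 0)"
  have t: "0 \<le> t" using nonneg by (simp add: t_def)
  have "(\<Sum>j<m. h j * q j) \<le> (\<Sum>j<m. t * q j + (if j \<in> {..<r} then c * (h j - t) else 0))"
  proof (rule sum_mono)
    fix j assume j: "j \<in> {..<m}"
    show "h j * q j \<le> t * q j + (if j \<in> {..<r} then c * (h j - t) else 0)"
    proof (cases "j < r")
      case True
      then have "t \<le> h j"
        using anti nonneg j by (auto simp: t_def)
      then have "(h j - t) * q j \<le> (h j - t) * c"
        using q(1)[of j] j by (intro mult_left_mono) auto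
      then show ?thesis using True by (simp add: algebra_simps)
    next
      case False
      then have "h j \<le> t"
        using anti j by (auto simp: t_def)
      then show ?thesis
        using False q(2)[of j] j by (simp add: mult_right_mono)
    qed
  qed
  also have "\<dots> = t * (\<Sum>j<m. q j) + (\<Sum>j<r. c * (h j - t))"
  proof -
    have "{..<m} \<inter> {..<r} = {..<r}" using \<open>r \<le> m\<close> by auto
    then show ?thesis
      by (simp only: sum.distrib sum_distrib_left sum.inter_restrict[symmetric] finite_lessThan)
  qed
  also have "\<dots> \<le> t * (c * real r) + (\<Sum>j<r. c * (h j - t))"
    using sum_q t by (simp add: mult_left_mono)
  also have "\<dots> = c * (\<Sum>j<r. h j)"
    by (simp add: sum_distrib_left[symmetric] sum_subtractf algebra_simps)
  finally show ?thesis .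
qed

text \<open>Expand \<open>D\<close> in an orthonormal basis \<open>e\<close> of its range. By
  Cauchy-Schwarz over \<open>j\<close> and Bessel for both families, each of the at most
  \<open>r\<close> basis vectors contributes at most
  \<open>norm (e i) * norm (adjoint D (e i))\<close>, hence at most \<open>c\<close>.\<close>

lemma sum_abs_orthonormal_le:
  fixes D :: "'a::euclidean_space \<Rightarrow> 'b::euclidean_space"
  assumes "linear D" and D: "\<And>x. norm (D x) \<le> c * norm x" and "0 \<le> c"
    and "dim (range D) \<le> r"
    and z: "orthonormal z m" and y: "orthonormal y m"
  shows "(\<Sum>j<m. \<bar>D (z j) \<bullet> y j\<bar>) \<le> c * real r"
proof -
  define d where "d = dim (range D)"
  have "subspace (range D)"
    using linear_subspace_image[OF \<open>linear D\<close> subspace_UNIV] .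
  then obtain e where e: "orthonormal e d"
    and exp: "\<And>x. x \<in> range D \<Longrightarrow> (\<Sum>i<d. (e i \<bullet> x) *\<^sub>R e i) = x"
    unfolding d_def using orthonormal_basis_nat by blast
  let ?a = "\<lambda>i j. y j \<bullet> e i" and ?b = "\<lambda>i j. z j \<bullet> adjoint D (e i)"
  have "\<bar>D (z j) \<bullet> y j\<bar> \<le> (\<Sum>i<d. \<bar>?a i j\<bar> * \<bar>?b i j\<bar>)" for j
  proof -
    have "D (z j) \<bullet> y j = (\<Sum>i<d. (e i \<bullet> D (z j)) *\<^sub>R e i) \<bullet> y j"
      by (simp add: exp)
    also have "\<dots> = (\<Sum>i<d. ?a i j * ?b i j)"
      unfolding inner_sum_left
      by (simp add: adjoint_works[OF \<open>linear D\<close>] inner_commute mult.commute)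
    finally show ?thesis
      by (metis (no_types, lifting) abs_mult sum.cong sum_abs)
  qed
  then have "(\<Sum>j<m. \<bar>D (z j) \<bullet> y j\<bar>) \<le> (\<Sum>j<m. \<Sum>i<d. \<bar>?a i j\<bar> * \<bar>?b i j\<bar>)"
    by (intro sum_mono)
  also have "\<dots> = (\<Sum>i<d. \<Sum>j<m. \<bar>?a i j\<bar> * \<bar>?b i j\<bar>)"
    by (rule sum.swap)
  also have "\<dots> \<le> (\<Sum>i<d. c)"
  proof (rule sum_mono)
    fix i assume i: "i \<in> {..<d}"
    have ne: "norm (e i) = 1"
      using orthonormal_norm[OF e] i by simp
    have "L2_set (?a i) {..<m} \<le> norm (e i)"
      unfolding L2_set_def using orthonormal_bessel[OF y, of "e i"] by (intro real_le_lsqrt) auto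
    moreover have "L2_set (?b i) {..<m} \<le> norm (adjoint D (e i))"
      unfolding L2_set_def using orthonormal_bessel[OF z, of "adjoint D (e i)"]
      by (intro real_le_lsqrt) auto
    moreover have "norm (adjoint D (e i)) \<le> c"
      using norm_adjoint_le[OF \<open>linear D\<close> D \<open>0 \<le> c\<close>, of "e i"] ne by simp
    ultimately have "L2_set (?a i) {..<m} * L2_set (?b i) {..<m} \<le> 1 * c"
      using ne by (intro mult_mono) auto
    then show "(\<Sum>j<m. \<bar>?a i j\<bar> * \<bar>?b i j\<bar>) \<le> c"
      using L2_set_mult_ineq[of "?a i" "?b i" "{..<m}"] by simp
  qed
  also have "\<dots> = c * real d"
    by simp
  also have "\<dots> \<le> c * real r"
    using assms(4) \<open>0 \<le> c\<close> by (simp add: d_def mult_left_mono)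
  finally show ?thesis .
qed

text \<open>A singular value decomposition with full orthonormal bases \<open>v\<close> of the domain and \<open>u\<close> of the
  codomain. The values \<open>s j\<close> for \<open>j \<ge> min DIM('a) DIM('b)\<close> are irrelevant.\<close>

definition svd :: "('a::euclidean_space \<Rightarrow> 'b::euclidean_space) \<Rightarrow> (nat \<Rightarrow> real) \<Rightarrow> (nat \<Rightarrow> 'a) \<Rightarrow> (nat \<Rightarrow> 'b) \<Rightarrow> bool"
  where "svd F s v u \<longleftrightarrow> linear F \<and> orthonormal v DIM('a) \<and> orthonormal u DIM('b) \<and>
    (\<forall>j<DIM('a). F (v j) = (if j < DIM('b) then s j *\<^sub>R u j else 0)) \<and>
    (\<forall>j<min DIM('a) DIM('b). 0 \<le> s j) \<and>
    (\<forall>i j. i \<le> j \<longrightarrow> j < min DIM('a) DIM('b) \<longrightarrow> s j \<le> s i)"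

text \<open>For linear maps this is the trace of the adjoint of \<open>F\<close> composed with
  \<open>G\<close>, the pairing under which operator norm and nuclear norm are dual.\<close>

definition frobenius_inner :: "('a::euclidean_space \<Rightarrow> 'b::euclidean_space) \<Rightarrow> ('a \<Rightarrow> 'b) \<Rightarrow> real"
  where "frobenius_inner F G = (\<Sum>b\<in>Basis. F b \<bullet> G b)"

lemma frobenius_inner_orthonormal:
  fixes F G :: "'a::euclidean_space \<Rightarrow> 'b::euclidean_space"
  assumes "linear F" and "linear G" and z: "orthonormal z DIM('a)"
  shows "frobenius_inner F G = (\<Sum>j<DIM('a). F (z j) \<bullet> G (z j))"
proof -
  let ?N = "DIM('a)"
  have exp: "K b = (\<Sum>j<?N. (z j \<bullet> b) *\<^sub>R K (z j))" if "linear K" for K :: "'a \<Rightarrow> 'b" and b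
  proof -
    have "K b = K (\<Sum>j<?N. (z j \<bullet> b) *\<^sub>R z j)"
      by (simp add: orthonormal_expand[OF z])
    then show ?thesis
      using that by (simp add: linear_sum linear_scale)
  qed
  have "F b \<bullet> G b = (\<Sum>i<?N. \<Sum>j<?N. (z i \<bullet> b) * (z j \<bullet> b) * (F (z j) \<bullet> G (z i)))" for b
    by (subst exp[OF assms(1)], subst exp[OF assms(2)])
      (simp add: inner_sum_left inner_sum_right sum_distrib_left algebra_simps)
  then have "frobenius_inner F G
      = (\<Sum>b\<in>Basis. \<Sum>i<?N. \<Sum>j<?N. (z i \<bullet> b) * (z j \<bullet> b) * (F (z j) \<bullet> G (z i)))"
    by (simp add: frobenius_inner_def)
  also have "\<dots> = (\<Sum>i<?N. \<Sum>j<?N. \<Sum>b\<in>Basis. (z i \<bullet> b) * (z j \<bullet> b) * (F (z j) \<bullet> G (z i)))"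
    by (subst sum.swap, intro sum.cong refl, rule sum.swap)
  also have "\<dots> = (\<Sum>i<?N. \<Sum>j<?N. (z i \<bullet> z j) * (F (z j) \<bullet> G (z i)))"
    by (simp add: sum_distrib_right[symmetric] euclidean_inner[symmetric])
  also have "\<dots> = (\<Sum>i<?N. \<Sum>j<?N. if j = i then F (z j) \<bullet> G (z j) else 0)"
    by (intro sum.cong) (auto simp: orthonormal_inner[OF z])
  finally show ?thesis
    by simp
qed

lemma frobenius_inner_svd:
  fixes D F :: "'a::euclidean_space \<Rightarrow> 'b::euclidean_space"
  assumes "linear D" and "svd F s v u"
  shows "frobenius_inner D F = (\<Sum>j<min DIM('a) DIM('b). s j * (D (v j) \<bullet> u j))"
proof -
  have "frobenius_inner D F = (\<Sum>j<DIM('a). D (v j) \<bullet> F (v j))"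
    using assms by (intro frobenius_inner_orthonormal) (auto simp: svd_def)
  also have "\<dots> = (\<Sum>j<DIM('a). if j < DIM('b) then s j * (D (v j) \<bullet> u j) else 0)"
    using assms(2) by (intro sum.cong) (auto simp: svd_def)
  also have "\<dots> = (\<Sum>j<min DIM('a) DIM('b). s j * (D (v j) \<bullet> u j))"
    by (intro sum.mono_neutral_cong_right) auto
  finally show ?thesis .
qed

text \<open>In the singular bases the inner product is a sum of the \<open>s j\<close> with weights
  \<open>D (v j) \<bullet> u j\<close>. In absolute value each weight is at most \<open>c\<close>
  and all together are at most \<open>c * r\<close>, so \<open>weighted_sum_le_top\<close>
  applies.\<close>

lemma frobenius_inner_le_top:
  fixes D F :: "'a::euclidean_space \<Rightarrow> 'b::euclidean_space"
  assumes "linear D" and D: "\<And>x. norm (D x) \<le> c * norm x" and "0 \<le> c"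
    and "dim (range D) \<le> r" and "r \<le> min DIM('a) DIM('b)" and F: "svd F s v u"
  shows "frobenius_inner D F \<le> c * (\<Sum>j<r. s j)"
proof -
  let ?m = "min DIM('a) DIM('b)"
  have v: "orthonormal v ?m" and u: "orthonormal u ?m"
    using F by (auto simp: svd_def intro: orthonormal_mono)
  have "frobenius_inner D F = (\<Sum>j<?m. s j * (D (v j) \<bullet> u j))"
    by (rule frobenius_inner_svd) fact+
  also have "\<dots> \<le> (\<Sum>j<?m. s j * \<bar>D (v j) \<bullet> u j\<bar>)"
    using F by (intro sum_mono mult_left_mono) (auto simp: svd_def)
  also have "\<dots> \<le> c * (\<Sum>j<r. s j)"
  proof (rule weighted_sum_le_top)
    show "\<bar>D (v j) \<bullet> u j\<bar> \<le> c" if "j < ?m" for j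
      using Cauchy_Schwarz_ineq2[of "D (v j)" "u j"] D[of "v j"]
        orthonormal_norm[OF v that] orthonormal_norm[OF u that] by simp
    show "(\<Sum>j<?m. \<bar>D (v j) \<bullet> u j\<bar>) \<le> c * real r"
      by (rule sum_abs_orthonormal_le) fact+
  qed (use F assms in \<open>auto simp: svd_def\<close>)
  finally show ?thesis .
qed

section \<open>Householder reflections and low-rank corrections of isometries\<close>

text \<open>The Householder reflection in the hyperplane orthogonal to \<open>p - q\<close> swaps
  \<open>p\<close> and \<open>q\<close> because their norms agree. The third conclusion protects
  frame vectors already in place; the fourth bounds the rank of \<open>S - id\<close> by
  one.\<close>

lemma reflection_exists:
  fixes p q :: "'a::euclidean_space"
  assumes "norm p = norm q"
  obtains S where "orthogonal_transformation S" and "S p = q"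
    and "\<And>x. x \<bullet> p = x \<bullet> q \<Longrightarrow> S x = x" and "\<And>x. S x - x \<in> span {p - q}"
proof (cases "p = q")
  case True
  then show ?thesis
    by (intro that[of "\<lambda>x. x"]) (auto intro: span_zero simp: orthogonal_transformation_def linear_iff)
next
  case False
  define a where "a = p - q"
  define S where "S x = x - (2 * (a \<bullet> x) / (a \<bullet> a)) *\<^sub>R a" for x
  have a: "a \<bullet> a \<noteq> 0" using False by (simp add: a_def)
  have pq: "p \<bullet> p = q \<bullet> q"
    using assms by (simp add: norm_eq)
  show ?thesis
  proof (rule that)
    have "linear S"
      by (rule linearI) (simp_all add: S_def algebra_simps add_divide_distrib)
    moreover have "S x \<bullet> S y = x \<bullet> y" for x y
    proof -
      define k l where "k = 2 * (a \<bullet> x) / (a \<bullet> a)" and "l = 2 * (a \<bullet> y) / (a \<bullet> a)"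
      have "S x \<bullet> S y = x \<bullet> y - l * (a \<bullet> x) - k * (a \<bullet> y) + k * (l * (a \<bullet> a))"
        unfolding S_def k_def[symmetric] l_def[symmetric] inner_diff_left inner_diff_right
          inner_scaleR_left inner_scaleR_right inner_commute[of x a] by (simp add: right_diff_distrib)
      moreover have "l * (a \<bullet> x) = k * (a \<bullet> y)" and "l * (a \<bullet> a) = 2 * (a \<bullet> y)"
        using a by (simp_all add: k_def l_def)
      ultimately show ?thesis by simp
    qed
    ultimately show "orthogonal_transformation S"
      by (simp add: orthogonal_transformation_def)
    have "2 * (a \<bullet> p) = a \<bullet> a"
      using pq by (simp add: a_def inner_diff_left inner_diff_right inner_commute)
    then show "S p = q"
      using a by (simp add: S_def) (simp add: a_def)
    show "S x = x" if "x \<bullet> p = x \<bullet> q" for x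
    proof -
      have "a \<bullet> x = 0"
        using that unfolding a_def inner_diff_left by (simp add: inner_commute)
      then show ?thesis by (simp add: S_def)
    qed
    show "S x - x \<in> span {p - q}" for x
      by (simp add: S_def a_def[symmetric] span_neg span_scale span_base)
  qed
qed

text \<open>\<open>R\<close> is a product of \<open>k\<close> Householder reflections, each of which changes the rank of
  \<open>R - id\<close> by at most one.\<close>

lemma orthogonal_transformation_moving_frame:
  fixes p q :: "nat \<Rightarrow> 'a::euclidean_space"
  assumes "orthonormal p k" and "orthonormal q k"
  obtains R where "orthogonal_transformation R" and "\<And>j. j < k \<Longrightarrow> R (p j) = q j"
    and "dim (range (\<lambda>x. R x - x)) \<le> k"
proof -
  have "\<exists>R. orthogonal_transformation R \<and> (\<forall>j<k. R (p j) = q j) \<and> dim (range (\<lambda>x. R x - x)) \<le> k"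
    using assms
  proof (induction k)
    case 0
    have "orthogonal_transformation (\<lambda>x::'a. x)"
      by (auto simp: orthogonal_transformation_def linear_iff)
    moreover have "dim (range (\<lambda>x::'a. x - x)) = 0"
      by simp
    ultimately show ?case
      by (intro exI[of _ "\<lambda>x. x"]) auto
  next
    case (Suc k)
    then obtain R where R: "orthogonal_transformation R" "\<And>j. j < k \<Longrightarrow> R (p j) = q j"
      "dim (range (\<lambda>x. R x - x)) \<le> k"
      using orthonormal_mono[of _ "Suc k" k] by (metis le_SucI order_refl)
    have "norm (R (p k)) = norm (q k)"
      using Suc.prems by (simp add: orthogonal_transformation_norm[OF R(1)] orthonormal_norm)
    then obtain S where S: "orthogonal_transformation S" "S (R (p k)) = q k"
      "\<And>x. x \<bullet> R (p k) = x \<bullet> q k \<Longrightarrow> S x = x" "\<And>x. S x - x \<in> span {R (p k) - q k}"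
      by (rule reflection_exists) blast
    have "S (R (p j)) = q j" if "j < Suc k" for j
    proof (cases "j = k")
      case False
      with that have j: "j < k" by simp
      \<comment> \<open>Since \<open>R\<close> preserves inner products, \<open>q j\<close> is
        orthogonal to both \<open>R (p k)\<close> and \<open>q k\<close>, so \<open>S\<close> fixes
        it.\<close>
      have "q j \<bullet> R (p k) = p j \<bullet> p k"
        using R(1) R(2)[OF j] unfolding orthogonal_transformation_def by metis
      also have "\<dots> = q j \<bullet> q k"
        using Suc.prems j by (simp add: orthonormal_inner)
      finally show ?thesis
        using S(3) R(2)[OF j] by simp
    qed (simp add: S(2))
    moreover have "dim (range (\<lambda>x. S (R x) - x)) \<le> Suc k"
    proof -
      \<comment> \<open>Splitting \<open>S (R x) - x\<close> into
        \<open>(S (R x) - R x) + (R x - x)\<close> shows that only the direction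
        \<open>R (p k) - q k\<close> is added to the span of the old range.\<close>
      let ?T = "insert (R (p k) - q k) (range (\<lambda>x. R x - x))"
      have "S (R x) - x \<in> span ?T" for x
      proof -
        have "S (R x) - R x \<in> span ?T"
          using S(4)[of "R x"] span_mono[of "{R (p k) - q k}" ?T] by auto
        moreover have "R x - x \<in> span ?T"
          by (rule span_base) auto
        ultimately have "(S (R x) - R x) + (R x - x) \<in> span ?T"
          by (rule span_add)
        then show ?thesis by simp
      qed
      then have "dim (range (\<lambda>x. S (R x) - x)) \<le> dim (span ?T)"
        by (intro dim_subset) auto
      also have "\<dots> \<le> Suc (dim (range (\<lambda>x. R x - x)))"
        by (simp add: dim_insert)
      finally show ?thesis using R(3) by simp
    qed
    moreover have "orthogonal_transformation (S \<circ> R)"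
      using S(1) R(1) by (rule orthogonal_transformation_compose)
    ultimately show ?case
      by (intro exI[of _ "S \<circ> R"]) (auto simp: o_def)
  qed
  then show ?thesis using that by blast
qed

text \<open>Transporting an orthonormal frame needs a map that preserves inner products. If
  \<open>DIM('a) \<le> DIM('b)\<close>, then \<open>J\<close> is one, and \<open>R\<close> corrects
  it in the codomain by taking \<open>J (v j)\<close> to \<open>u j\<close>. Otherwise the adjoint
  \<open>K\<close> of \<open>J\<close> is one, and \<open>R\<close> acts in the domain, taking
  \<open>v j\<close> to \<open>K (u j)\<close>.\<close>

lemma contraction_through_frame:
  fixes v z :: "nat \<Rightarrow> 'a::euclidean_space" and u y :: "nat \<Rightarrow> 'b::euclidean_space"
  assumes z: "orthonormal z DIM('a)" and y: "orthonormal y DIM('b)"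
    and v: "orthonormal v r" and u: "orthonormal u r"
  defines "J \<equiv> \<lambda>x. \<Sum>j<min DIM('a) DIM('b). (z j \<bullet> x) *\<^sub>R y j"
  obtains W where "linear W" and "\<And>x. norm (W x) \<le> norm x" and "\<And>j. j < r \<Longrightarrow> W (v j) = u j"
    and "dim (range (\<lambda>x. J x - W x)) \<le> r"
proof -
  let ?m = "min DIM('a) DIM('b)"
  have zm: "orthonormal z ?m" and ym: "orthonormal y ?m"
    using z y by (auto intro: orthonormal_mono)
  have J: "linear J" "\<And>x. norm (J x) \<le> norm x" "\<And>j. j < ?m \<Longrightarrow> J (z j) = y j"
    unfolding J_def by (fact orthonormal_map[OF zm ym])+
  show ?thesis
  proof (cases "DIM('a) \<le> DIM('b)")
    case True
    then have m: "?m = DIM('a)" by simp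
    have inner_J: "J x \<bullet> J x' = x \<bullet> x'" for x x'
      unfolding J_def inner_orthonormal_sum[OF ym] unfolding m by (rule orthonormal_parseval[OF z])
    have "orthonormal (\<lambda>j. J (v j)) r"
      using v by (simp add: orthonormal_def inner_J)
    then obtain R where R: "orthogonal_transformation R" "\<And>j. j < r \<Longrightarrow> R (J (v j)) = u j"
      "dim (range (\<lambda>x. R x - x)) \<le> r"
      using orthogonal_transformation_moving_frame[OF _ u] by blast
    show ?thesis
    proof (rule that[of "R \<circ> J"])
      show "linear (R \<circ> J)"
        using J(1) orthogonal_transformation_linear[OF R(1)] by (rule linear_compose)
      have "range (\<lambda>x. J x - (R \<circ> J) x) \<subseteq> span (range (\<lambda>x. R x - x))"
      proof (rule image_subsetI)
        fix x
        have "- (R (J x) - J x) \<in> span (range (\<lambda>x. R x - x))"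
          by (intro span_neg span_base) (rule rangeI)
        then show "J x - (R \<circ> J) x \<in> span (range (\<lambda>x. R x - x))"
          by simp
      qed
      then have "dim (range (\<lambda>x. J x - (R \<circ> J) x)) \<le> dim (span (range (\<lambda>x. R x - x)))"
        by (rule dim_subset)
      then show "dim (range (\<lambda>x. J x - (R \<circ> J) x)) \<le> r"
        using R(3) by simp
      show "norm ((R \<circ> J) x) \<le> norm x" for x
        using J(2)[of x] by (simp add: orthogonal_transformation_norm[OF R(1)])
      show "(R \<circ> J) (v j) = u j" if "j < r" for j
        using R(2)[OF that] by simp
    qed
  next
    case False
    then have m: "?m = DIM('b)" by simp
    define K where "K = (\<lambda>w. \<Sum>j<?m. (y j \<bullet> w) *\<^sub>R z j)"
    have inner_K: "K w \<bullet> K w' = w \<bullet> w'" for w w'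
      unfolding K_def inner_orthonormal_sum[OF zm] unfolding m by (rule orthonormal_parseval[OF y])
    have JK: "J (K w) = w" for w
    proof -
      have "J (K w) = (\<Sum>j<?m. (y j \<bullet> w) *\<^sub>R y j)"
        unfolding K_def using J(1,3) by (simp add: linear_sum linear_scale)
      then show ?thesis
        unfolding m using orthonormal_expand[OF y] by simp
    qed
    have "orthonormal (\<lambda>j. K (u j)) r"
      using u by (simp add: orthonormal_def inner_K)
    then obtain R where R: "orthogonal_transformation R" "\<And>j. j < r \<Longrightarrow> R (v j) = K (u j)"
      "dim (range (\<lambda>x. R x - x)) \<le> r"
      using orthogonal_transformation_moving_frame[OF v] by blast
    show ?thesis
    proof (rule that[of "J \<circ> R"])
      show "linear (J \<circ> R)"
        using orthogonal_transformation_linear[OF R(1)] J(1) by (rule linear_compose)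
      show "norm ((J \<circ> R) x) \<le> norm x" for x
        using J(2)[of "R x"] by (simp add: orthogonal_transformation_norm[OF R(1)])
      have "J x - (J \<circ> R) x = (\<lambda>x. - J x) (R x - x)" for x
        by (simp add: linear_diff[OF J(1)])
      then have "range (\<lambda>x. J x - (J \<circ> R) x) = (\<lambda>x. - J x) ` range (\<lambda>x. R x - x)"
        by (simp add: image_image)
      moreover have "linear (\<lambda>x. - J x)"
        using J(1) by (rule linear_compose_neg)
      ultimately have "dim (range (\<lambda>x. J x - (J \<circ> R) x)) \<le> dim (range (\<lambda>x. R x - x))"
        by (simp only: dim_image_le)
      then show "dim (range (\<lambda>x. J x - (J \<circ> R) x)) \<le> r"
        using R(3) by simp
      show "(J \<circ> R) (v j) = u j" if "j < r" for j
        using R(2)[OF that] JK by simp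
    qed
  qed
qed

section \<open>Perturbation of the sum of singular values\<close>

lemma svd_orthonormal:
  fixes F :: "'a::euclidean_space \<Rightarrow> 'b::euclidean_space"
  assumes "svd F s v u" and "r \<le> min DIM('a) DIM('b)"
  shows "orthonormal v r" and "orthonormal u r"
  using assms by (auto simp: svd_def intro: orthonormal_mono)

lemma frobenius_inner_add:
  "frobenius_inner F (\<lambda>x. G x + K x) = frobenius_inner F G + frobenius_inner F K"
  by (simp add: frobenius_inner_def inner_add_right sum.distrib)

lemma frobenius_inner_diff_left:
  "frobenius_inner (\<lambda>x. F x - G x) K = frobenius_inner F K - frobenius_inner G K"
  by (simp add: frobenius_inner_def inner_diff_left sum_subtractf)

text \<open>This is the instance of Mirsky's inequality \<open>\<Sum>\<bar>\<sigma>\<^sub>i(A) - \<sigma>\<^sub>i(- B)\<bar> \<le> \<Sum>\<sigma>\<^sub>i(A + B)\<close> needed for \<open>A\<close> of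
  rank at most \<open>r\<close>. Mirsky's general proof uses Weyl monotonicity of a Hermitian dilation; here
  testing \<open>A + B\<close> against a contraction that agrees with \<open>B\<close>'s polar isometry up to rank \<open>r\<close> suffices.\<close>

lemma sum_singular_values_perturbation:
  fixes A B :: "'a::euclidean_space \<Rightarrow> 'b::euclidean_space"
  assumes A: "svd A \<sigma> v u" and B: "svd B h z y" and X: "svd (\<lambda>x. A x + B x) s w x"
    and r: "r \<le> min DIM('a) DIM('b)"
    and rank: "\<And>k. r \<le> k \<Longrightarrow> k < min DIM('a) DIM('b) \<Longrightarrow> \<sigma> k = 0"
  shows "(\<Sum>k<r. \<sigma> k) + (\<Sum>j<min DIM('a) DIM('b). h j) - 2 * (\<Sum>j<r. h j)
    \<le> (\<Sum>j<min DIM('a) DIM('b). s j)"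
proof -
  let ?m = "min DIM('a) DIM('b)"
  let ?J = "\<lambda>x. \<Sum>j<?m. (z j \<bullet> x) *\<^sub>R y j"
  obtain W where W: "linear W" "\<And>x. norm (W x) \<le> norm x" "\<And>j. j < r \<Longrightarrow> W (v j) = u j"
    "dim (range (\<lambda>x. ?J x - W x)) \<le> r"
  proof (rule contraction_through_frame)
    show "orthonormal z DIM('a)" and "orthonormal y DIM('b)"
      using B by (simp_all add: svd_def)
    show "orthonormal v r" and "orthonormal u r"
      by (rule svd_orthonormal[OF A r])+
  qed (rule that)
  note J = orthonormal_map[OF svd_orthonormal[OF B order_refl]]
  have "frobenius_inner W A = (\<Sum>k<?m. \<sigma> k * (W (v k) \<bullet> u k))"
    by (rule frobenius_inner_svd[OF W(1) A])
  also have "\<dots> = (\<Sum>k<r. \<sigma> k * (W (v k) \<bullet> u k))"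
    using r rank by (intro sum.mono_neutral_right) auto
  also have "\<dots> = (\<Sum>k<r. \<sigma> k)"
    using W(3) orthonormal_inner[OF svd_orthonormal(2)[OF A r]] by simp
  finally have WA: "frobenius_inner W A = (\<Sum>k<r. \<sigma> k)" .
  have "frobenius_inner ?J B = (\<Sum>j<?m. h j * (?J (z j) \<bullet> y j))"
    by (rule frobenius_inner_svd[OF J(1) B])
  also have "\<dots> = (\<Sum>j<?m. h j)"
    using J(3) orthonormal_inner[OF svd_orthonormal(2)[OF B order_refl]] by simp
  finally have JB: "frobenius_inner ?J B = (\<Sum>j<?m. h j)" .
  \<comment> \<open>The constant 2 is the operator bound for a difference of two
    contractions.\<close>
  have "frobenius_inner (\<lambda>x. ?J x - W x) B \<le> 2 * (\<Sum>j<r. h j)"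
  proof (rule frobenius_inner_le_top[OF _ _ _ W(4) r B])
    show "linear (\<lambda>x. ?J x - W x)"
      using J(1) W(1) by (rule linear_compose_sub)
    show "norm (?J x - W x) \<le> 2 * norm x" for x
      using norm_triangle_ineq4[of "?J x" "W x"] J(2)[of x] W(2)[of x] by linarith
  qed simp
  then have WB: "frobenius_inner W B \<ge> (\<Sum>j<?m. h j) - 2 * (\<Sum>j<r. h j)"
    using JB by (simp add: frobenius_inner_diff_left)
  \<comment> \<open>With \<open>?m\<close> as the rank bound, Ky Fan's inequality becomes the
    duality of operator norm and nuclear norm.\<close>
  have "dim (range W) \<le> ?m"
    using dim_image_le[OF W(1), of UNIV] dim_subset_UNIV[of "range W"] by simp
  then have "frobenius_inner W (\<lambda>x. A x + B x) \<le> 1 * (\<Sum>j<?m. s j)"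
    using W(1,2) by (intro frobenius_inner_le_top[OF _ _ _ _ _ X]) auto
  then show ?thesis
    using WA WB by (simp add: frobenius_inner_add)
qed

section \<open>Concavity and slope of the fractional penalty\<close>

lemma frac_penalty_0 [simp]: "frac_penalty \<alpha> 0 = 0"
  by (simp add: frac_penalty_def)

lemma frac_penalty_eq:
  assumes "\<alpha> > 0" and "0 \<le> t"
  shows "frac_penalty \<alpha> t = 1 - 1 / (1 + \<alpha> * t)"
proof -
  have "1 + \<alpha> * t > 0"
    using assms by (simp add: add_pos_nonneg)
  then show ?thesis
    using assms by (simp add: frac_penalty_def field_simps)
qed

text \<open>This is concavity: the coefficient of \<open>x - d\<close> is the derivative at
  \<open>d\<close>, and the gap to the tangent is
  \<open>(a - b)\<^sup>2 / (a * b\<^sup>2)\<close>.\<close>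

lemma frac_penalty_tangent:
  assumes "\<alpha> > 0" and "0 \<le> x" and "0 \<le> d"
  shows "frac_penalty \<alpha> x \<le> frac_penalty \<alpha> d + \<alpha> / (1 + \<alpha> * d)\<^sup>2 * (x - d)"
proof -
  define a b where "a = 1 + \<alpha> * x" and "b = 1 + \<alpha> * d"
  have pos: "a > 0" "b > 0"
    using assms by (auto simp: a_def b_def add_pos_nonneg)
  have x: "frac_penalty \<alpha> x = 1 - 1 / a" and d: "frac_penalty \<alpha> d = 1 - 1 / b"
    using assms by (simp_all add: frac_penalty_eq a_def b_def)
  have "\<alpha> / b\<^sup>2 * (x - d) = (a - b) / b\<^sup>2"
    by (simp add: a_def b_def algebra_simps)
  moreover have "(1 - 1 / b) + (a - b) / b\<^sup>2 - (1 - 1 / a) = (a - b)\<^sup>2 / (a * b\<^sup>2)"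
    using pos by (simp add: field_simps power2_eq_square)
  moreover have "0 \<le> (a - b)\<^sup>2 / (a * b\<^sup>2)"
    using pos by simp
  ultimately show ?thesis
    unfolding x d b_def[symmetric] by linarith
qed

lemma frac_penalty_mono:
  assumes "\<alpha> > 0" and "0 \<le> x" and "x \<le> y"
  shows "frac_penalty \<alpha> x \<le> frac_penalty \<alpha> y"
proof -
  have "1 / (1 + \<alpha> * y) \<le> 1 / (1 + \<alpha> * x)"
    using assms by (intro divide_left_mono mult_pos_pos add_pos_nonneg) auto
  then show ?thesis
    using assms by (simp add: frac_penalty_eq)
qed

text \<open>The increment is \<open>\<alpha> * e / (a * (a + \<alpha> * e))\<close> with
  \<open>a = 1 + \<alpha> * s\<close>, and the denominator exceeds 1. When some error term is
  nonzero, the strictness of the penalty bound comes from here.\<close>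

lemma frac_penalty_add_less:
  assumes "\<alpha> > 0" and "0 \<le> s" and "0 < e"
  shows "frac_penalty \<alpha> (s + e) < frac_penalty \<alpha> s + \<alpha> * e"
proof -
  define a where "a = 1 + \<alpha> * s"
  have a: "1 \<le> a" and e: "0 < \<alpha> * e"
    using assms by (auto simp: a_def)
  have "frac_penalty \<alpha> (s + e) = 1 - 1 / (a + \<alpha> * e)" and "frac_penalty \<alpha> s = 1 - 1 / a"
    using assms by (simp_all add: frac_penalty_eq a_def distrib_left add.assoc)
  moreover have "1 / a - 1 / (a + \<alpha> * e) = \<alpha> * e / (a * (a + \<alpha> * e))"
    using a e by (simp add: field_simps)
  moreover have "\<alpha> * e / (a * (a + \<alpha> * e)) < \<alpha> * e / 1"
  proof (rule divide_strict_left_mono)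
    have "1 * 1 < a * (a + \<alpha> * e)"
      using a e by (intro mult_le_less_imp_less) auto
    then show "1 < a * (a + \<alpha> * e)" by simp
  qed (use a e in auto)
  ultimately show ?thesis by simp
qed

text \<open>Averaging the tangent at the mean \<open>d\<close> proves this; the missing mass
  \<open>1 - P\<close> behaves as if placed at 0, where the penalty vanishes.\<close>

lemma frac_penalty_jensen:
  assumes "\<alpha> > 0" and \<sigma>: "\<And>k. k < n \<Longrightarrow> 0 \<le> \<sigma> k" and p: "\<And>k. k < n \<Longrightarrow> 0 \<le> p k"
    and "(\<Sum>k<n. p k) \<le> 1"
  shows "(\<Sum>k<n. p k * frac_penalty \<alpha> (\<sigma> k)) \<le> frac_penalty \<alpha> (\<Sum>k<n. p k * \<sigma> k)"
proof -
  define d where "d = (\<Sum>k<n. p k * \<sigma> k)"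
  define g where "g = \<alpha> / (1 + \<alpha> * d)\<^sup>2"
  define P where "P = (\<Sum>k<n. p k)"
  have d: "0 \<le> d"
    unfolding d_def using \<sigma> p by (intro sum_nonneg) auto
  have "(\<Sum>k<n. p k * frac_penalty \<alpha> (\<sigma> k)) \<le> (\<Sum>k<n. p k * (frac_penalty \<alpha> d + g * (\<sigma> k - d)))"
    unfolding g_def using assms d by (intro sum_mono mult_left_mono frac_penalty_tangent) auto
  also have "\<dots> = (\<Sum>k<n. p k * (frac_penalty \<alpha> d - g * d) + g * (p k * \<sigma> k))"
    by (intro sum.cong) (auto simp: algebra_simps)
  also have "\<dots> = P * (frac_penalty \<alpha> d - g * d) + g * d"
    unfolding sum.distrib sum_distrib_left[symmetric] sum_distrib_right[symmetric]
      P_def[symmetric] d_def[symmetric] ..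
  also have "\<dots> = frac_penalty \<alpha> d - (1 - P) * (frac_penalty \<alpha> d - g * d)"
    by (simp add: algebra_simps)
  \<comment> \<open>The tangent at \<open>d\<close>, evaluated at 0, gives
    \<open>g * d \<le> frac_penalty \<alpha> d\<close>.\<close>
  also have "\<dots> \<le> frac_penalty \<alpha> d"
    using frac_penalty_tangent[OF assms(1) order_refl d] assms(4) by (simp add: g_def P_def)
  finally show ?thesis
    by (simp add: d_def)
qed

section \<open>Perturbation of the penalty\<close>

lemma svd_apply:
  fixes A :: "'a::euclidean_space \<Rightarrow> 'b::euclidean_space"
  assumes A: "svd A \<sigma> v u" and "r \<le> min DIM('a) DIM('b)"
    and rank: "\<And>k. r \<le> k \<Longrightarrow> k < min DIM('a) DIM('b) \<Longrightarrow> \<sigma> k = 0"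
  shows "A x = (\<Sum>k<r. (\<sigma> k * (v k \<bullet> x)) *\<^sub>R u k)"
proof -
  have v: "orthonormal v DIM('a)" and "linear A"
    and Av: "\<And>j. j < DIM('a) \<Longrightarrow> A (v j) = (if j < DIM('b) then \<sigma> j *\<^sub>R u j else 0)"
    using A by (auto simp: svd_def)
  have "A x = A (\<Sum>k<DIM('a). (v k \<bullet> x) *\<^sub>R v k)"
    by (simp add: orthonormal_expand[OF v])
  also have "\<dots> = (\<Sum>k<DIM('a). (v k \<bullet> x) *\<^sub>R A (v k))"
    using \<open>linear A\<close> by (simp add: linear_sum linear_scale)
  also have "\<dots> = (\<Sum>k<r. (v k \<bullet> x) *\<^sub>R A (v k))"
    using assms(2) rank Av by (intro sum.mono_neutral_right) auto
  also have "\<dots> = (\<Sum>k<r. (\<sigma> k * (v k \<bullet> x)) *\<^sub>R u k)"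
    using assms(2) Av by (intro sum.cong) auto
  finally show ?thesis .
qed

text \<open>Write \<open>\<bar>A\<bar> = U\<^sup>T A\<close> for the polar decomposition and expand it in the right singular basis \<open>w\<close> of
  \<open>A + B\<close>. By Jensen the penalty of \<open>A\<close> is at most that of the diagonal \<open>\<langle>w\<^sub>i, U\<^sup>T A w\<^sub>i\<rangle>\<close>, which is at
  most \<open>s\<^sub>i - \<langle>U w\<^sub>i, B w\<^sub>i\<rangle>\<close>. After fixing signs, the error terms sum to the Frobenius inner product of
  \<open>B\<close> with a contraction of rank at most \<open>r\<close>.\<close>

lemma sum_frac_penalty_perturbation:
  fixes A B :: "'a::euclidean_space \<Rightarrow> 'b::euclidean_space"
  assumes "\<alpha> > 0" and A: "svd A \<sigma> v u" and B: "svd B h z y" and X: "svd (\<lambda>x. A x + B x) s w x"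
    and r: "r \<le> min DIM('a) DIM('b)"
    and rank: "\<And>k. r \<le> k \<Longrightarrow> k < min DIM('a) DIM('b) \<Longrightarrow> \<sigma> k = 0"
    and pos: "0 < (\<Sum>j<r. h j)"
  shows "(\<Sum>k<r. frac_penalty \<alpha> (\<sigma> k))
    < (\<Sum>j<min DIM('a) DIM('b). frac_penalty \<alpha> (s j)) + \<alpha> * (\<Sum>j<r. h j)"
proof -
  let ?m = "min DIM('a) DIM('b)" and ?N = "DIM('a)" and ?f = "frac_penalty \<alpha>"
  define U where "U = (\<lambda>x. \<Sum>k<r. (v k \<bullet> x) *\<^sub>R u k)"
  have vr: "orthonormal v r" and ur: "orthonormal u r"
    by (rule svd_orthonormal[OF A r])+
  have U: "linear U" "\<And>x. norm (U x) \<le> norm x" "dim (range U) \<le> r"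
    unfolding U_def by (fact orthonormal_map[OF vr ur])+
  have w: "orthonormal w ?N" and xb: "orthonormal x DIM('b)" and linB: "linear B"
    and Xw: "\<And>j. j < ?N \<Longrightarrow> A (w j) + B (w j) = (if j < DIM('b) then s j *\<^sub>R x j else 0)"
    and s: "\<And>j. j < ?m \<Longrightarrow> 0 \<le> s j"
    using X B by (auto simp: svd_def)
  have \<sigma>: "0 \<le> \<sigma> k" if "k < r" for k
    using A r that by (auto simp: svd_def)
  define d where "d i = (\<Sum>k<r. (v k \<bullet> w i)\<^sup>2 * \<sigma> k)" for i
  define e where "e i = U (w i) \<bullet> B (w i)" for i
  \<comment> \<open>Sums over the basis \<open>w\<close> have \<open>?N\<close> terms, while
    \<open>s\<close> is meaningful only below \<open>?m\<close>; it is continued by 0.\<close>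
  define S where "S i = (if i < ?m then s i else 0)" for i
  have S: "0 \<le> S i" for i
    using s by (simp add: S_def)
  have norm_w: "norm (w i) = 1" if "i < ?N" for i
    using orthonormal_norm[OF w that] .

  \<comment> \<open>The squares \<open>(v k \<bullet> w i)\<^sup>2\<close> sum to 1 over
    \<open>i\<close>, which splits each penalty over the basis \<open>w\<close>, and to at most 1
    over \<open>k\<close>, which admits Jensen after swapping the sums.\<close>
  have "(\<Sum>k<r. ?f (\<sigma> k)) = (\<Sum>k<r. \<Sum>i<?N. (v k \<bullet> w i)\<^sup>2 * ?f (\<sigma> k))"
  proof (rule sum.cong)
    fix k assume "k \<in> {..<r}"
    then have "norm (v k) = 1"
      using orthonormal_norm[OF vr] by simp
    then have "(\<Sum>i<?N. (v k \<bullet> w i)\<^sup>2) = 1"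
      using orthonormal_parseval[OF w, of "v k" "v k"]
      by (simp add: power2_eq_square inner_commute norm_eq_1)
    then show "?f (\<sigma> k) = (\<Sum>i<?N. (v k \<bullet> w i)\<^sup>2 * ?f (\<sigma> k))"
      by (simp add: sum_distrib_right[symmetric])
  qed simp
  also have "\<dots> = (\<Sum>i<?N. \<Sum>k<r. (v k \<bullet> w i)\<^sup>2 * ?f (\<sigma> k))"
    by (rule sum.swap)
  also have "\<dots> \<le> (\<Sum>i<?N. ?f (d i))"
    unfolding d_def
  proof (intro sum_mono frac_penalty_jensen)
    fix i assume "i \<in> {..<?N}"
    then show "(\<Sum>k<r. (v k \<bullet> w i)\<^sup>2) \<le> 1"
      using orthonormal_bessel[OF vr, of "w i"] norm_w by simp
  qed (use \<open>\<alpha> > 0\<close> \<sigma> in auto)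
  also have "\<dots> \<le> (\<Sum>i<?N. ?f (S i + \<bar>e i\<bar>))"
  proof (intro sum_mono frac_penalty_mono)
    fix i assume "i \<in> {..<?N}"
    then have i: "i < ?N" by simp
    show "0 \<le> d i"
      unfolding d_def using \<sigma> by (intro sum_nonneg) auto
    have "A (w i) = (\<Sum>k<r. (\<sigma> k * (v k \<bullet> w i)) *\<^sub>R u k)"
      by (rule svd_apply[OF A r]) (rule rank)
    then have "d i = U (w i) \<bullet> A (w i)"
      unfolding U_def by (simp only: inner_orthonormal_sum[OF ur])
        (simp add: d_def power2_eq_square mult_ac)
    also have "\<dots> = U (w i) \<bullet> (A (w i) + B (w i)) - e i"
      by (simp add: e_def inner_add_right)
    also have "U (w i) \<bullet> (A (w i) + B (w i)) \<le> S i"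
    proof (cases "i < DIM('b)")
      case True
      have "U (w i) \<bullet> x i \<le> norm (U (w i)) * norm (x i)"
        by (rule norm_cauchy_schwarz)
      then have "U (w i) \<bullet> x i \<le> 1"
        using U(2)[of "w i"] norm_w[OF i] orthonormal_norm[OF xb True] by simp
      then have "s i * (U (w i) \<bullet> x i) \<le> s i * 1"
        using s[of i] i True by (intro mult_left_mono) auto
      then show ?thesis
        using i True by (simp add: Xw S_def)
    qed (simp add: Xw[OF i] S)
    finally show "d i \<le> S i + \<bar>e i\<bar>"
      by linarith
  qed (use \<open>\<alpha> > 0\<close> in auto)
  finally have le: "(\<Sum>k<r. ?f (\<sigma> k)) \<le> (\<Sum>i<?N. ?f (S i + \<bar>e i\<bar>))" .

  \<comment> \<open>The signs turn \<open>\<bar>e i\<bar>\<close> into \<open>c i * e i\<close>, so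
    that the errors form a single Frobenius inner product; \<open>C\<close> is a contraction, and
    \<open>U \<circ> C\<close> keeps rank at most \<open>r\<close>.\<close>
  define c where "c i = (if e i \<ge> 0 then 1 else - 1 :: real)" for i
  define C where "C = (\<lambda>x. \<Sum>i<?N. (c i * (w i \<bullet> x)) *\<^sub>R w i)"
  have "linear C"
    by (rule linearI) (simp_all add: C_def algebra_simps sum.distrib scaleR_sum_right)
  have "norm (C t) \<le> norm t" for t
  proof (rule power2_le_imp_le)
    have "(norm (C t))\<^sup>2 = (\<Sum>i<?N. (w i \<bullet> t)\<^sup>2)"
      unfolding C_def norm_orthonormal_sum[OF w]
      by (intro sum.cong) (auto simp: power_mult_distrib c_def)
    then show "(norm (C t))\<^sup>2 \<le> (norm t)\<^sup>2"
      using orthonormal_bessel[OF w] by simp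
  qed simp
  then have UC: "norm ((U \<circ> C) t) \<le> 1 * norm t" for t
    using U(2)[of "C t"] order_trans by fastforce
  have linUC: "linear (U \<circ> C)"
    using \<open>linear C\<close> U(1) by (rule linear_compose)
  have Cw: "C (w i) = c i *\<^sub>R w i" if "i < ?N" for i
  proof -
    have "C (w i) = (\<Sum>j<?N. if j = i then c i *\<^sub>R w i else 0)"
      unfolding C_def using that by (intro sum.cong) (auto simp: orthonormal_inner[OF w])
    then show ?thesis using that by simp
  qed
  have "(\<Sum>i<?N. \<bar>e i\<bar>) = (\<Sum>i<?N. (U \<circ> C) (w i) \<bullet> B (w i))"
    by (intro sum.cong) (auto simp: Cw linear_scale[OF U(1)] e_def c_def)
  also have "\<dots> = frobenius_inner (U \<circ> C) B"
    by (rule frobenius_inner_orthonormal[symmetric, OF linUC linB w])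
  also have "\<dots> \<le> 1 * (\<Sum>j<r. h j)"
  proof (rule frobenius_inner_le_top[OF linUC UC _ _ r B])
    have "range (U \<circ> C) \<subseteq> range U"
      by auto
    then show "dim (range (U \<circ> C)) \<le> r"
      using U(3) dim_subset order_trans by blast
  qed simp
  finally have e: "(\<Sum>i<?N. \<bar>e i\<bar>) \<le> (\<Sum>j<r. h j)"
    by simp

  have "(\<Sum>i<?N. ?f (S i)) = (\<Sum>i<?m. ?f (S i))"
    by (rule sum.mono_neutral_right) (auto simp: S_def)
  then have fS: "(\<Sum>i<?N. ?f (S i)) = (\<Sum>i<?m. ?f (s i))"
    by (simp add: S_def)
  have step: "?f (S i + \<bar>e i\<bar>) \<le> ?f (S i) + \<alpha> * \<bar>e i\<bar>" for i
    using frac_penalty_add_less[OF \<open>\<alpha> > 0\<close> S, of "\<bar>e i\<bar>" i] by (cases "e i = 0") auto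
  show ?thesis
  \<comment> \<open>Without errors, strictness comes from \<open>pos\<close>; otherwise it comes
    from an index with \<open>e i \<noteq> 0\<close>.\<close>
  proof (cases "\<forall>i<?N. e i = 0")
    case True
    then have "(\<Sum>k<r. ?f (\<sigma> k)) \<le> (\<Sum>i<?m. ?f (s i))"
      using le fS by simp
    also have "\<dots> < (\<Sum>i<?m. ?f (s i)) + \<alpha> * (\<Sum>j<r. h j)"
      using pos \<open>\<alpha> > 0\<close> by simp
    finally show ?thesis .
  next
    case False
    then obtain i where i: "i < ?N" "e i \<noteq> 0" by blast
    then have "?f (S i + \<bar>e i\<bar>) < ?f (S i) + \<alpha> * \<bar>e i\<bar>"
      using \<open>\<alpha> > 0\<close> S by (intro frac_penalty_add_less) auto
    then have "(\<Sum>i<?N. ?f (S i + \<bar>e i\<bar>)) < (\<Sum>i<?N. ?f (S i) + \<alpha> * \<bar>e i\<bar>)"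
      using i step by (intro sum_strict_mono_ex1) auto
    also have "\<dots> = (\<Sum>i<?m. ?f (s i)) + \<alpha> * (\<Sum>i<?N. \<bar>e i\<bar>)"
      by (simp add: sum.distrib sum_distrib_left fS)
    also have "\<dots> \<le> (\<Sum>i<?m. ?f (s i)) + \<alpha> * (\<Sum>j<r. h j)"
      using e \<open>\<alpha> > 0\<close> by simp
    finally show ?thesis
      using le by simp
  qed
qed

section \<open>Spectral theorem and singular values of matrices\<close>

text \<open>The eigenvectors are found one at a time by maximizing the Rayleigh quotient on the orthogonal
  complement of the previous ones, so the eigenvalues come out in decreasing order.\<close>

lemma self_adjoint_eigenbasis:
  fixes T :: "'a::euclidean_space \<Rightarrow> 'a"
  assumes "linear T" and sym: "\<And>x y. T x \<bullet> y = x \<bullet> T y"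
  obtains v where "orthonormal v DIM('a)"
    and "\<And>i. i < DIM('a) \<Longrightarrow> T (v i) = (v i \<bullet> T (v i)) *\<^sub>R v i"
    and "\<And>i j. i \<le> j \<Longrightarrow> j < DIM('a) \<Longrightarrow> v j \<bullet> T (v j) \<le> v i \<bullet> T (v i)"
proof -
  \<comment> \<open>The maximality clause covers every \<open>y\<close> orthogonal to the earlier
    vectors; applied to later \<open>v j\<close> it yields the decreasing order.\<close>
  define good where "good v k \<longleftrightarrow> orthonormal v k \<and>
    (\<forall>i<k. T (v i) = (v i \<bullet> T (v i)) *\<^sub>R v i \<and>
      (\<forall>y. (\<forall>j<i. v j \<bullet> y = 0) \<longrightarrow> y \<bullet> T y \<le> (v i \<bullet> T (v i)) * (y \<bullet> y)))" for v k
  have "\<exists>v. good v k" if "k \<le> DIM('a)" for k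
    using that
  proof (induction k)
    case 0
    show ?case by (simp add: good_def orthonormal_def)
  next
    case (Suc k)
    then obtain v where v: "good v k" by auto
    then have on: "orthonormal v k"
      and ev: "\<And>i. i < k \<Longrightarrow> T (v i) = (v i \<bullet> T (v i)) *\<^sub>R v i"
      by (auto simp: good_def)
    define S where "S = {y. norm y = 1 \<and> (\<forall>j<k. v j \<bullet> y = 0)}"
    have "closed (\<Inter>j<k. {y. v j \<bullet> y = 0})"
      by (intro closed_INT ballI closed_hyperplane)
    moreover have "S = sphere 0 1 \<inter> (\<Inter>j<k. {y. v j \<bullet> y = 0})"
      by (auto simp: S_def)
    ultimately have "compact S"
      using compact_Int_closed[OF compact_sphere] by simp
    moreover have "S \<noteq> {}"
      using orthonormal_vector_exists[of k v] Suc.prems by (auto simp: S_def)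
    moreover have "continuous_on S (\<lambda>y. y \<bullet> T y)"
      using \<open>linear T\<close> by (intro continuous_intros linear_continuous_on linear_conv_bounded_linear[THEN iffD1])
    ultimately obtain x where x: "x \<in> S" and max: "\<And>y. y \<in> S \<Longrightarrow> y \<bullet> T y \<le> x \<bullet> T x"
      using continuous_attains_sup by metis
    define l where "l = x \<bullet> T x"
    have xx: "x \<bullet> x = 1" and vx: "\<And>j. j < k \<Longrightarrow> v j \<bullet> x = 0"
      using x by (auto simp: S_def norm_eq_1)
    have max': "y \<bullet> T y \<le> l * (y \<bullet> y)" if y: "\<And>j. j < k \<Longrightarrow> v j \<bullet> y = 0" for y
    proof (cases "y = 0")
      case False
      then have "y /\<^sub>R norm y \<in> S"
        using y by (simp add: S_def)
      from max[OF this] have "(y \<bullet> T y) / (norm y)\<^sup>2 \<le> l"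
        by (simp add: l_def linear_scale[OF \<open>linear T\<close>] power2_eq_square divide_inverse mult_ac)
      then show ?thesis
        using False by (simp add: pos_divide_le_eq power2_norm_eq_inner)
    qed (simp add: linear_0[OF \<open>linear T\<close>])
    define z where "z = T x - l *\<^sub>R x"
    have "v j \<bullet> z = 0" if "j < k" for j
    proof -
      have "v j \<bullet> T x = T (v j) \<bullet> x"
        by (simp add: sym)
      also have "\<dots> = 0"
        using ev[OF that] vx[OF that] by (metis inner_scaleR_left mult_zero_right)
      finally show ?thesis
        using vx[OF that] by (simp add: z_def inner_diff_right)
    qed
    note vz = this
    have xz: "x \<bullet> z = 0"
      by (simp add: z_def inner_diff_right xx l_def)
    have zTx: "z \<bullet> T x = z \<bullet> z"
      using xz by (simp add: z_def inner_diff_left inner_diff_right inner_commute)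
    have "z = 0"
    proof (rule ccontr)
      assume "z \<noteq> 0"
      \<comment> \<open>Along \<open>x + t *\<^sub>R z\<close> the first-order gain is
        \<open>2 * t * a\<close> and the quadratic loss at most \<open>t\<^sup>2 * c\<close>. The
        choice \<open>t = a / c\<close> reduces this loss to \<open>t * a\<close>; the
        \<open>+ 1\<close> keeps \<open>c\<close> positive.\<close>
      define a c where "a = z \<bullet> z" and "c = \<bar>l * (z \<bullet> z) - z \<bullet> T z\<bar> + 1"
      have a: "a > 0" and c: "c > 0"
        using \<open>z \<noteq> 0\<close> by (auto simp: a_def c_def)
      define t where "t = a / c"
      have t: "t > 0" using a c by (simp add: t_def)
      have le: "(x + t *\<^sub>R z) \<bullet> T (x + t *\<^sub>R z) \<le> l * ((x + t *\<^sub>R z) \<bullet> (x + t *\<^sub>R z))"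
        using vx vz by (intro max') (simp add: inner_add_right)
      have lhs: "(x + t *\<^sub>R z) \<bullet> T (x + t *\<^sub>R z) = l + 2 * t * a + t\<^sup>2 * (z \<bullet> T z)"
      proof -
        have "x \<bullet> T z = a"
          using zTx sym[of x z] by (simp add: a_def inner_commute)
        then show ?thesis
          using zTx by (simp add: linear_add[OF \<open>linear T\<close>] linear_scale[OF \<open>linear T\<close>]
              l_def a_def power2_eq_square algebra_simps)
      qed
      have rhs: "(x + t *\<^sub>R z) \<bullet> (x + t *\<^sub>R z) = 1 + t\<^sup>2 * (z \<bullet> z)"
        using xx xz by (simp add: inner_add_left inner_add_right inner_commute power2_eq_square)
      have "2 * t * a \<le> t\<^sup>2 * (l * (z \<bullet> z) - z \<bullet> T z)"
        using le unfolding lhs rhs by (simp add: algebra_simps)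
      also have "\<dots> \<le> t\<^sup>2 * c"
        by (intro mult_left_mono) (auto simp: c_def)
      also have "\<dots> = t * a"
        using c by (simp add: power2_eq_square t_def)
      finally show False
        using t a by simp
    qed
    then have Tx: "T x = l *\<^sub>R x"
      by (simp add: z_def)
    have "good (v(k := x)) (Suc k)"
      unfolding good_def
    proof (intro conjI allI impI)
      show "orthonormal (v(k := x)) (Suc k)"
        using x vx by (intro orthonormal_upd on) (auto simp: S_def)
      fix i assume i: "i < Suc k"
      show "T ((v(k := x)) i) = ((v(k := x)) i \<bullet> T ((v(k := x)) i)) *\<^sub>R (v(k := x)) i"
        using i ev[of i] Tx by (auto simp: less_Suc_eq l_def[symmetric] xx)
      fix y assume y: "\<forall>j<i. (v(k := x)) j \<bullet> y = 0"
      show "y \<bullet> T y \<le> ((v(k := x)) i \<bullet> T ((v(k := x)) i)) * (y \<bullet> y)"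
      proof (cases "i = k")
        case True
        then show ?thesis
          using y max'[of y] by (simp add: l_def[symmetric])
      next
        case False
        then have "i < k" using i by simp
        then have "\<forall>j<i. v j \<bullet> y = 0"
          using y by simp
        with v \<open>i < k\<close> have "y \<bullet> T y \<le> (v i \<bullet> T (v i)) * (y \<bullet> y)"
          unfolding good_def by blast
        then show ?thesis using False by simp
      qed
    qed
    then show ?case by blast
  qed
  then obtain v where v: "good v DIM('a)" by blast
  show ?thesis
  proof (rule that)
    show on: "orthonormal v DIM('a)"
      using v by (simp add: good_def)
    show "T (v i) = (v i \<bullet> T (v i)) *\<^sub>R v i" if "i < DIM('a)" for i
      using v that unfolding good_def by blast
    show "v j \<bullet> T (v j) \<le> v i \<bullet> T (v i)" if "i \<le> j" "j < DIM('a)" for i j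
    proof -
      have "\<forall>k<i. v k \<bullet> v j = 0"
        using that by (simp add: orthonormal_inner[OF on])
      then have "v j \<bullet> T (v j) \<le> (v i \<bullet> T (v i)) * (v j \<bullet> v j)"
        using v that unfolding good_def by (meson order_le_less_trans)
      then show ?thesis
        using that by (simp add: orthonormal_inner[OF on])
    qed
  qed
qed

text \<open>With the eigenvectors as columns of \<open>P\<close>, \<open>A ** P = P ** D\<close> for
  a diagonal \<open>D\<close>. Lifted to polynomial matrices, this relates the two characteristic
  matrices, and the nonzero \<open>det (C P)\<close> cancels, leaving the product of the
  \<open>[:- l i, 1:]\<close>. This ties an eigenbasis to the multiset behind
  \<open>singular_values\<close>.\<close>

lemma proots_char_polynomial:
  fixes A :: "real ^ 'n ^ 'n"
  assumes v: "orthonormal v CARD('n)" and ev: "\<And>i. i < CARD('n) \<Longrightarrow> A *v v i = l i *\<^sub>R v i"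
  shows "proots (char_polynomial A) = image_mset l (mset [0..<CARD('n)])"
proof -
  obtain b :: "'n \<Rightarrow> nat" where b: "bij_betw b UNIV {0..<CARD('n)}"
    using ex_bij_betw_finite_nat[of "UNIV :: 'n set"] by auto
  have b_less: "b j < CARD('n)" for j
    using bij_betwE[OF b] by auto
  have b_eq: "b i = b j \<longleftrightarrow> i = j" for i j
    using b by (auto simp: bij_betw_def inj_on_def)
  define C :: "real ^ 'n ^ 'n \<Rightarrow> real poly ^ 'n ^ 'n" where "C M = (\<chi> i j. [: M $ i $ j :])" for M
  have C_mult: "C (M ** N) = C M ** C N" for M N
  proof -
    have "[:\<Sum>k\<in>S. f k:] = (\<Sum>k\<in>S. [:f k:])" for f :: "'n \<Rightarrow> real" and S
    proof (rule poly_eqI)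
      show "coeff [:\<Sum>k\<in>S. f k:] n = coeff (\<Sum>k\<in>S. [:f k:]) n" for n
        by (cases n) (simp_all add: coeff_sum)
    qed
    then show ?thesis
      by (simp add: C_def vec_eq_iff matrix_matrix_mult_def mult.commute)
  qed
  define P :: "real ^ 'n ^ 'n" where "P = (\<chi> i j. v (b j) $ i)"
  have PP: "transpose P ** P = mat 1"
    using orthonormal_inner[OF v b_less b_less]
    by (simp add: P_def vec_eq_iff matrix_matrix_mult_def transpose_def mat_def inner_vec_def b_eq)
  define D :: "real ^ 'n ^ 'n" where "D = (\<chi> i j. if i = j then l (b j) else 0)"
  have AP: "A ** P = P ** D"
  proof -
    have "(A ** P) $ i $ j = (P ** D) $ i $ j" for i j
    proof -
      have "(A ** P) $ i $ j = (A *v v (b j)) $ i"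
        by (simp add: P_def matrix_matrix_mult_def matrix_vector_mult_def)
      also have "\<dots> = v (b j) $ i * l (b j)"
        by (simp add: ev[OF b_less])
      also have "\<dots> = (P ** D) $ i $ j"
        by (simp add: P_def D_def matrix_matrix_mult_def mult_delta_right)
      finally show ?thesis .
    qed
    then show ?thesis
      by (simp add: vec_eq_iff)
  qed
  have matrix_diff_mult: "(M - N) ** K = M ** K - N ** K"
    and matrix_mult_diff: "K ** (M - N) = K ** M - K ** N" for K M N :: "real poly ^ 'n ^ 'n"
    by (simp_all add: vec_eq_iff matrix_matrix_mult_def left_diff_distrib right_diff_distrib sum_subtractf)
  let ?X = "mat [:0, 1:] :: real poly ^ 'n ^ 'n"
  have X_comm: "?X ** M = M ** ?X" for M :: "real poly ^ 'n ^ 'n"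
    by (simp add: vec_eq_iff matrix_matrix_mult_def mat_def mult_delta_left mult_delta_right)
  have "(?X - C A) ** C P = C P ** (?X - C D)"
    by (simp add: matrix_diff_mult matrix_mult_diff X_comm AP flip: C_mult)
  then have "det (?X - C A) * det (C P) = det (C P) * det (?X - C D)"
    by (metis det_mul)
  moreover have "det (C P) \<noteq> 0"
  proof
    assume "det (C P) = 0"
    then have "det (C (transpose P ** P)) = 0"
      by (simp add: C_mult det_mul)
    moreover have "C (mat 1) = mat 1"
      by (simp add: C_def vec_eq_iff mat_def one_pCons)
    ultimately show False
      by (simp add: PP)
  qed
  ultimately have "det (?X - C A) = det (?X - C D)"
    by (simp add: mult.commute)
  also have "\<dots> = (\<Prod>i\<in>UNIV. [:- l (b i), 1:])"
    by (subst det_diagonal) (simp_all add: C_def D_def mat_def)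
  also have "\<dots> = (\<Prod>i\<in>{0..<CARD('n)}. [:- l i, 1:])"
    by (rule prod.reindex_bij_betw[OF b])
  finally have "char_polynomial A = (\<Prod>i\<in>{0..<CARD('n)}. [:- l i, 1:])"
    by (simp add: char_polynomial_def C_def)
  then have "proots (char_polynomial A) = (\<Sum>i\<in>{0..<CARD('n)}. {#l i#})"
    by (simp add: proots_prod)
  also have "\<dots> = image_mset l (mset [0..<CARD('n)])"
  proof -
    have "(\<Sum>i\<in>{0..<n}. {#l i#}) = image_mset l (mset [0..<n])" for n
      by (induction n) simp_all
    then show ?thesis .
  qed
  finally show ?thesis .
qed

text \<open>An eigenbasis of \<open>transpose X ** X\<close> supplies the right singular vectors,
  with eigenvalues the squares of \<open>norm (X *v v j)\<close>. The normalized nonzero images are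
  left singular vectors and are completed to a basis. \<open>Suc j\<close> converts to indices that
  start at 1.\<close>

lemma matrix_svd:
  fixes X :: "real ^ 'n2 ^ 'n1"
  obtains v u where "svd ((*v) X) (\<lambda>j. singular_value (Suc j) X) v u"
proof -
  let ?N = "CARD('n2)" and ?T = "\<lambda>x. (transpose X ** X) *v x"
  have quad: "x \<bullet> ?T y = (X *v x) \<bullet> (X *v y)" for x y
    by (metis dot_lmul_matrix matrix_vector_mul_assoc vector_transpose_matrix)
  obtain v where v: "orthonormal v ?N"
    and ev: "\<And>i. i < ?N \<Longrightarrow> ?T (v i) = (v i \<bullet> ?T (v i)) *\<^sub>R v i"
    and dec: "\<And>i j. i \<le> j \<Longrightarrow> j < ?N \<Longrightarrow> v j \<bullet> ?T (v j) \<le> v i \<bullet> ?T (v i)"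
  proof (rule self_adjoint_eigenbasis)
    show "linear ?T" by simp
    show "?T x \<bullet> y = x \<bullet> ?T y" for x y
      by (metis inner_commute quad)
  qed (simp add: that)
  define s where "s j = norm (X *v v j)" for j
  have s_nonneg: "0 \<le> s j" for j
    by (simp add: s_def)
  have l: "v j \<bullet> ?T (v j) = (s j)\<^sup>2" for j
    by (simp add: quad s_def power2_norm_eq_inner)
  have s_dec: "s j \<le> s i" if "i \<le> j" "j < ?N" for i j
    using dec[OF that] by (simp add: l s_def)
  let ?L = "map s [0..<?N]"
  have roots: "proots (char_polynomial (transpose X ** X)) = image_mset (\<lambda>j. (s j)\<^sup>2) (mset [0..<?N])"
    using ev by (intro proots_char_polynomial[of v]) (simp_all add: v l)
  have "image_mset sqrt (proots (char_polynomial (transpose X ** X))) = mset (rev ?L)"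
    unfolding roots by (simp add: image_mset.compositionality o_def s_nonneg)
  then have "singular_values X = rev (sort (rev ?L))"
    unfolding singular_values_def by (simp only: sorted_list_of_multiset_mset)
  moreover have "sorted (rev ?L)"
    by (simp add: sorted_rev_iff_nth_mono s_dec)
  ultimately have "singular_values X = ?L"
    by (simp only: sorted_sort_id rev_rev_ident)
  then have sv: "singular_value (Suc j) X = s j" if "j < ?N" for j
    using that by (simp add: singular_value_def)

  \<comment> \<open>\<open>p\<close> counts the nonzero \<open>s j\<close> below \<open>?N\<close>;
    the disjunct \<open>?N \<le> j\<close> supplies a witness when none of them vanishes.\<close>
  define p where "p = (LEAST j. ?N \<le> j \<or> s j = 0)"
  have "?N \<le> p \<or> s p = 0"
    unfolding p_def by (rule LeastI[of _ ?N]) simp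
  moreover have "s j = 0" if "p \<le> j" "j < ?N" "s p = 0" for j
    using s_dec[OF that(1,2)] that(3) by (simp add: s_def)
  ultimately have zero: "s j = 0" if "p \<le> j" "j < ?N" for j
    using that by force
  have p: "j < ?N \<and> 0 < s j" if "j < p" for j
    using not_less_Least[OF that[unfolded p_def]] by (simp add: s_def)
  define u0 where "u0 j = (X *v v j) /\<^sub>R s j" for j
  have "orthonormal u0 p"
    unfolding orthonormal_def
  proof (intro allI impI)
    fix i j assume ij: "i < p" "j < p"
    have "(X *v v i) \<bullet> (X *v v j) = v i \<bullet> ((s j)\<^sup>2 *\<^sub>R v j)"
      using ev[of j] p[OF ij(2)] by (simp add: quad[symmetric] l)
    also have "\<dots> = (if i = j then (s j)\<^sup>2 else 0)"
      using p ij by (simp add: orthonormal_inner[OF v])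
    finally have XX: "(X *v v i) \<bullet> (X *v v j) = (if i = j then (s j)\<^sup>2 else 0)" .
    have uu: "u0 i \<bullet> u0 j = inverse (s j) * (inverse (s i) * ((X *v v i) \<bullet> (X *v v j)))"
      unfolding u0_def inner_scaleR_left inner_scaleR_right ..
    show "u0 i \<bullet> u0 j = (if i = j then 1 else 0)"
    proof (cases "i = j")
      case True
      have "norm (u0 j) = 1"
        using p[OF ij(2)] by (simp add: u0_def s_def)
      then show ?thesis
        using True by (simp add: norm_eq_1)
    qed (simp add: uu XX)
  qed
  then obtain u where u: "orthonormal u CARD('n1)" and u0: "\<And>j. j < p \<Longrightarrow> u j = u0 j"
    and "p \<le> CARD('n1)"
    using orthonormal_extend[of u0 p "CARD('n1)"] orthonormal_le_DIM[of u0 p] by auto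
  \<comment> \<open>Because \<open>p \<le> CARD('n1)\<close>, an index past the codomain dimension
    falls in the vanishing case.\<close>
  have Xv: "X *v v j = (if j < CARD('n1) then s j *\<^sub>R u j else 0)" if "j < ?N" for j
  proof (cases "j < p")
    case True
    then show ?thesis
      using p[OF True] \<open>p \<le> CARD('n1)\<close> by (simp add: u0 u0_def)
  next
    case False
    then have "s j = 0" using zero that by simp
    then show ?thesis by (simp add: s_def)
  qed
  have "svd ((*v) X) (\<lambda>j. singular_value (Suc j) X) v u"
    unfolding svd_def
  proof (intro conjI allI impI)
    show "X *v v j = (if j < DIM(real ^ 'n1) then singular_value (Suc j) X *\<^sub>R u j else 0)"
      if "j < DIM(real ^ 'n2)" for j
      using that Xv[of j] by (simp add: sv)
    show "0 \<le> singular_value (Suc j) X" if "j < min DIM(real ^ 'n2) DIM(real ^ 'n1)" for j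
      using that by (simp add: sv s_nonneg)
    show "singular_value (Suc j) X \<le> singular_value (Suc i) X"
      if "i \<le> j" and "j < min DIM(real ^ 'n2) DIM(real ^ 'n1)" for i j
      using that by (simp add: sv s_dec)
  qed (use v u in simp_all)
  then show ?thesis by (rule that)
qed

text \<open>If \<open>s k\<close> were nonzero, the ordering would make \<open>s 0, ..., s k\<close>
  positive, and \<open>u 0, ..., u k\<close> would be \<open>Suc k\<close> orthonormal vectors in
  the range, more than the rank.\<close>

lemma singular_value_zero:
  fixes X :: "real ^ 'n2 ^ 'n1"
  assumes X: "svd ((*v) X) s v u" and "rank X \<le> k" and k: "k < min CARD('n1) CARD('n2)"
  shows "s k = 0"
proof (rule ccontr)
  assume "s k \<noteq> 0"
  then have pos: "0 < s j" if "j \<le> k" for j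
    using X k that by (force simp: svd_def)
  have "u j \<in> range ((*v) X)" if "j < Suc k" for j
  proof
    have "X *v v j = s j *\<^sub>R u j"
      using X k that by (simp add: svd_def)
    then show "u j = X *v (v j /\<^sub>R s j)"
      using pos[of j] that by (simp add: matrix_vector_mult_scaleR)
  qed simp
  moreover have "orthonormal u (Suc k)"
    using X k by (auto simp: svd_def intro: orthonormal_mono)
  ultimately have "Suc k \<le> dim (range ((*v) X))"
    by (intro orthonormal_le_dim) auto
  then show False
    using assms(2) by (simp add: rank_dim_range)
qed

section \<open>Unique minimality from the null space condition\<close>

theorem theorem3p5:
  fixes \<A> :: "real ^ 'n2 ^ 'n1 \<Rightarrow> real ^ 'n3"
    and \<alpha> \<beta> :: real
    and m r :: nat
  assumes "\<alpha> > 0" and "\<beta> > 0"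
    and "linear \<A>"
    and "m = min CARD('n1) CARD('n2)"
    and "1 \<le> r" and "r \<le> m"
    and "\<And>H. \<A> H = 0 \<Longrightarrow>
      (1 + \<beta> * \<alpha>) * (\<Sum>i = 1..r. singular_value i H) \<le> (\<Sum>i = r + 1..m. singular_value i H)"
  shows "\<forall>X\<^sub>0 b. rank X\<^sub>0 \<le> r \<and> b = \<A> X\<^sub>0 \<longrightarrow>
    {X. is_arg_min (\<lambda>X. nuclear_norm X + \<beta> * spectral_penalty \<alpha> X) (\<lambda>X. \<A> X = b) X} = {X\<^sub>0}"
proof (intro allI impI)
  fix X\<^sub>0 :: "real ^ 'n2 ^ 'n1" and b
  assume "rank X\<^sub>0 \<le> r \<and> b = \<A> X\<^sub>0"
  then have rank: "rank X\<^sub>0 \<le> r" and b: "b = \<A> X\<^sub>0" by auto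
  let ?F = "\<lambda>X. nuclear_norm X + \<beta> * spectral_penalty \<alpha> X"
  let ?sv = "\<lambda>X j. singular_value (Suc j) X" and ?f = "frac_penalty \<alpha>"
  have m: "m = min DIM(real ^ 'n2) DIM(real ^ 'n1)"
    using assms(4) by (simp add: min.commute)
  have F: "?F X = (\<Sum>j<m. ?sv X j) + \<beta> * (\<Sum>j<m. ?f (?sv X j))" for X :: "real ^ 'n2 ^ 'n1"
    by (simp add: nuclear_norm_def spectral_penalty_def assms(4) sum.atLeast1_atMost_eq)
  have less: "?F X\<^sub>0 < ?F X" if X: "\<A> X = b" "X \<noteq> X\<^sub>0" for X
  proof -
    define H where "H = X - X\<^sub>0"
    define h where "h = (\<Sum>j<r. ?sv H j)"
    have "\<A> H = 0"
      using X b by (simp add: H_def linear_diff[OF assms(3)])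
    then have "(1 + \<beta> * \<alpha>) * (\<Sum>i = 1..r. singular_value i H) \<le> (\<Sum>i = r + 1..m. singular_value i H)"
      by (rule assms(7))
    moreover have "(\<Sum>i = 1..r. singular_value i H) + (\<Sum>i = r + 1..m. singular_value i H)
        = (\<Sum>i = 1..m. singular_value i H)"
      using \<open>r \<le> m\<close> sum.ub_add_nat[of 1 r "\<lambda>i. singular_value i H" "m - r"] by simp
    ultimately have null: "(1 + \<beta> * \<alpha>) * h \<le> (\<Sum>j<m. ?sv H j) - h"
      by (simp add: h_def sum.atLeast1_atMost_eq)
    obtain v u where A: "svd ((*v) X\<^sub>0) (?sv X\<^sub>0) v u"
      by (rule matrix_svd)
    obtain z y where B: "svd ((*v) H) (?sv H) z y"
      by (rule matrix_svd)
    obtain w x where "svd ((*v) X) (?sv X) w x"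
      by (rule matrix_svd)
    moreover have "(*v) X = (\<lambda>x. X\<^sub>0 *v x + H *v x)"
      by (simp add: H_def matrix_vector_mult_diff_rdistrib fun_eq_iff)
    ultimately have AB: "svd (\<lambda>x. X\<^sub>0 *v x + H *v x) (?sv X) w x"
      by simp
    have zero: "?sv X\<^sub>0 k = 0" if "r \<le> k" "k < m" for k
      using rank that assms(4) by (intro singular_value_zero[OF A]) auto
    have h_nonneg: "0 \<le> ?sv H j" and h_le: "?sv H j \<le> ?sv H 0" if "j < m" for j
      using B that by (auto simp: svd_def m)
    \<comment> \<open>As \<open>1 \<le> r\<close>, the largest singular value of \<open>H\<close> is
      at most \<open>h\<close>; if \<open>h\<close> were not positive, all would vanish and
      \<open>H\<close> would be 0.\<close>
    have "0 < h"
    proof (rule ccontr)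
      assume "\<not> 0 < h"
      moreover have "?sv H 0 \<le> h"
        unfolding h_def using assms(5,6) h_nonneg by (intro member_le_sum) auto
      ultimately have "?sv H j = 0" if "j < m" for j
        using h_nonneg[OF that] h_le[OF that] by linarith
      then have "H *v x = 0" for x
        using svd_apply[OF B, of 0 x] by (simp add: m)
      then have "H = 0"
        by (simp add: matrix_eq)
      then show False
        using X(2) by (simp add: H_def)
    qed
    have "(\<Sum>j<r. ?sv X\<^sub>0 j) + (\<Sum>j<m. ?sv H j) - 2 * h \<le> (\<Sum>j<m. ?sv X j)"
      unfolding h_def m
      by (rule sum_singular_values_perturbation[OF A B AB]) (use zero assms(6) m in auto)
    \<comment> \<open>The null space condition reads
      \<open>(\<Sum>j<m. ?sv H j) - 2 * h \<ge> \<beta> * \<alpha> * h\<close>, exactly the surplus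
      that pays for the loss in the penalty term.\<close>
    then have nuc: "(\<Sum>j<r. ?sv X\<^sub>0 j) + \<beta> * (\<alpha> * h) \<le> (\<Sum>j<m. ?sv X j)"
      using null by (simp add: algebra_simps)
    have "(\<Sum>j<r. ?f (?sv X\<^sub>0 j)) < (\<Sum>j<m. ?f (?sv X j)) + \<alpha> * h"
      unfolding h_def m
      by (rule sum_frac_penalty_perturbation[OF assms(1) A B AB])
        (use zero assms(6) m \<open>0 < h\<close> h_def in auto)
    then have pen: "\<beta> * (\<Sum>j<r. ?f (?sv X\<^sub>0 j)) < \<beta> * (\<Sum>j<m. ?f (?sv X j)) + \<beta> * (\<alpha> * h)"
      using assms(2) by (simp flip: distrib_left)
    have "(\<Sum>j<m. ?sv X\<^sub>0 j) = (\<Sum>j<r. ?sv X\<^sub>0 j)"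
      using zero assms(6) by (intro sum.mono_neutral_right) auto
    moreover have "(\<Sum>j<m. ?f (?sv X\<^sub>0 j)) = (\<Sum>j<r. ?f (?sv X\<^sub>0 j))"
      using zero assms(6) by (intro sum.mono_neutral_right) auto
    ultimately show ?thesis
      unfolding F using nuc pen by simp
  qed
  show "{X. is_arg_min ?F (\<lambda>X. \<A> X = b) X} = {X\<^sub>0}"
  proof (intro equalityI subsetI)
    fix X assume "X \<in> {X. is_arg_min ?F (\<lambda>X. \<A> X = b) X}"
    then show "X \<in> {X\<^sub>0}"
      using less[of X] b by (auto simp: is_arg_min_def)
  next
    fix X assume "X \<in> {X\<^sub>0}"
    then show "X \<in> {X. is_arg_min ?F (\<lambda>X. \<A> X = b) X}"
      using less b by (force simp: is_arg_min_def)
  qed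
qed

end
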